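(* Let $d\ge 2$ and $D\ge 1$ be integers, and let $G$ be a finite graph that has a $d$-degenerate vertex ordering of depth $D$. Then \[ \mathrm{HG}(G) < 2^{d^{D+1}}. \]
   Context: Hat guessing game: players sit on the vertices of a finite simple graph $G$; an adversary places on each vertex a hat of one of $q$ colors. Each player sees only the hat colors of its neighbors (not its own) and, following a strategy agreed in advance (a deterministic function of the colors it sees), guesses its own hat color; all guess simultaneously. The players win if at least one player guesses correctly. The hat guessing number $\mathrm{HG}(G)$ is the largest $q$ for which the players have a strategy that wins for every hat assignment with $q$ colors. A vertex ordering $v_1,\dots,v_n$ of $G$ is $d$-degenerate if each vertex has at most $d$ neighbors to its left (i.e. among earlier vertices). Such an ordering has depth $D$ if the longest left-to-right path (a path $v_{i_0}v_{i_1}\cdots v_{i_k}$ in $G$ with $i_0<i_1<\dots<i_k$) contains $D$ edges. *)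

theory Defs
  imports
    Main
    "HOL-Library.FuncSet"
    "HOL-Library.Extended_Nat"
    "Graph_Theory.Graph_Theory"
begin

section \<open>The hat guessing game\<close>

text \<open>
  A finite simple graph is a \<^locale>\<open>pair_graph\<close>: finitely many vertices, and a
  symmetric loop-free arc relation, each edge being represented by its two orientations.
\<close>

definition neighbors :: "'a pair_pre_digraph \<Rightarrow> 'a \<Rightarrow> 'a set" where
  "neighbors G v = {u. (u, v) \<in> parcs G}"

definition colorings :: "nat \<Rightarrow> 'a set \<Rightarrow> ('a \<Rightarrow> nat) set" where
  "colorings q S = S \<rightarrow>\<^sub>E {..<q}"

text \<open>
  The guess of the player at \<open>v\<close> is a function of a coloring of the neighbors of \<open>v\<close> only.
\<close>

definition hat_strategy ::
    "'a pair_pre_digraph \<Rightarrow> nat \<Rightarrow> ('a \<Rightarrow> ('a \<Rightarrow> nat) \<Rightarrow> nat) \<Rightarrow> bool" where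
  "hat_strategy G q s \<longleftrightarrow>
     (\<forall>v\<in>pverts G. s v \<in> colorings q (neighbors G v) \<rightarrow> {..<q})"

definition hat_winning ::
    "'a pair_pre_digraph \<Rightarrow> nat \<Rightarrow> ('a \<Rightarrow> ('a \<Rightarrow> nat) \<Rightarrow> nat) \<Rightarrow> bool" where
  "hat_winning G q s \<longleftrightarrow>
     (\<forall>c\<in>colorings q (pverts G). \<exists>v\<in>pverts G. s v (restrict c (neighbors G v)) = c v)"

text \<open>
  The supremum is taken in \<^typ>\<open>enat\<close>, so that it is the maximum if the set of
  admissible \<open>q\<close> is nonempty and finite, and \<open>\<infinity>\<close> (rather than an unspecified number) if that
  set is unbounded. The degenerate value \<open>q = 0\<close> does not influence the supremum.
\<close>

definition hat_guessing_number :: "'a pair_pre_digraph \<Rightarrow> enat" where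
  "hat_guessing_number G =
     Sup (enat ` {q. \<exists>s. hat_strategy G q s \<and> hat_winning G q s})"


section \<open>Vertex orderings\<close>

definition vertex_ordering :: "'a pair_pre_digraph \<Rightarrow> 'a list \<Rightarrow> bool" where
  "vertex_ordering G vs \<longleftrightarrow> distinct vs \<and> set vs = pverts G"

definition degenerate_ordering :: "'a pair_pre_digraph \<Rightarrow> nat \<Rightarrow> 'a list \<Rightarrow> bool" where
  "degenerate_ordering G d vs \<longleftrightarrow>
     vertex_ordering G vs \<and>
     (\<forall>j<length vs. card {i. i < j \<and> vs ! i \<in> neighbors G (vs ! j)} \<le> d)"

definition left_to_right_path :: "'a pair_pre_digraph \<Rightarrow> 'a list \<Rightarrow> 'a list \<Rightarrow> bool" where
  "left_to_right_path G vs p \<longleftrightarrow>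
     vpath p (with_proj G) \<and>
     (\<exists>js. sorted_wrt (<) js \<and> set js \<subseteq> {..<length vs} \<and> p = map ((!) vs) js)"

text \<open>The depth is measured in edges: \<^const>\<open>vwalk_length\<close> counts the arcs of a walk.\<close>

definition has_depth :: "'a pair_pre_digraph \<Rightarrow> 'a list \<Rightarrow> nat \<Rightarrow> bool" where
  "has_depth G vs D \<longleftrightarrow>
     (\<exists>p. left_to_right_path G vs p \<and> vwalk_length p = D) \<and>
     (\<forall>p. left_to_right_path G vs p \<longrightarrow> vwalk_length p \<le> D)"

end

theory Submission
  imports Defs
begin

text \<open>
  Group the vertices into levels by the length of the longest left-to-right path ending there.
  A level is independent, and the vertices of the top level have only lower neighbors, at most \<open>d\<close>
  of them. If the lower levels are restricted to a palette of \<open>h\<close> colors, such a vertex has at most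
  \<open>h ^ d\<close> possible guesses, so with \<open>h ^ d + 1\<close> colors the adversary can color it so that it is wrong
  whatever happens below. Once the top level is fixed, the rest is a game with one level fewer.
\<close>

text \<open>The adversary's palette against \<open>k\<close> levels. Starting at 1 rather than 0
  gives two colors to a single level, whose vertices see nothing and make one guess each, and makes
  powers monotone in the exponent.\<close>

fun losing_palette :: "nat \<Rightarrow> nat \<Rightarrow> nat" where
  "losing_palette d 0 = 1"
| "losing_palette d (Suc k) = losing_palette d k ^ d + 1"

lemma losing_palette_pos: "losing_palette d k \<ge> 1"
  by (cases k) auto

lemma losing_palette_Suc_ge:
  assumes "d \<ge> 1"
  shows "losing_palette d k \<le> losing_palette d (Suc k)"
  using self_le_power[of "losing_palette d k" d] losing_palette_pos[of d k] assms by simp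

text \<open>The slack of 2 covers both the \<open>+ 1\<close> of the recursion and the strict
  inequality in \<open>losing_palette_less\<close>. For \<open>d = 1\<close> it would read
  \<open>h + 2 \<le> h + 1\<close>, so this is where \<open>d \<ge> 2\<close> enters.\<close>

lemma power_plus_2_le:
  fixes h d :: nat
  assumes "h \<ge> 1" "d \<ge> 2"
  shows "h ^ d + 2 \<le> (h + 1) ^ d"
  using assms(2)
proof (induction d rule: dec_induct)
  case base
  then show ?case using assms(1) by (simp add: power2_eq_square)
next
  case (step n)
  have "h ^ Suc n + 2 \<le> (h ^ n + 2) * (h + 1)" by (simp add: algebra_simps)
  also have "\<dots> \<le> (h + 1) ^ n * (h + 1)" using step.IH by (rule mult_right_mono) simp
  finally show ?case by (simp add: mult.commute)
qed

text \<open>The bound \<open>b = 2 ^ (d ^ k)\<close> becomes exactly \<open>b ^ d\<close> at the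
  next step, and strictness, read as \<open>losing_palette d k + 1 \<le> b\<close>, absorbs the
  added 1.\<close>

lemma losing_palette_less:
  assumes "d \<ge> 2"
  shows "losing_palette d k < 2 ^ (d ^ k)"
proof (induction k)
  case 0
  then show ?case by simp
next
  case (Suc k)
  have "losing_palette d (Suc k) < (losing_palette d k + 1) ^ d"
    using power_plus_2_le[OF losing_palette_pos assms, of d k] by simp
  also have "\<dots> \<le> (2 ^ (d ^ k)) ^ d" using Suc by (intro power_mono) auto
  finally show ?case by (simp add: power_mult[symmetric] mult.commute)
qed

text \<open>Neighborhoods, levels and guesses are arbitrary functions, so that the induction on the
  number of levels can pass to the lower vertices with smaller neighborhoods and a modified
  strategy. Only lower neighbors are counted, because higher ones already have fixed colors when a
  vertex is treated.\<close>

lemma exists_losing_coloring: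
  fixes V :: "'a set" and N :: "'a \<Rightarrow> 'a set" and l :: "'a \<Rightarrow> nat"
    and s :: "'a \<Rightarrow> ('a \<Rightarrow> nat) \<Rightarrow> nat"
  assumes "finite V" "d \<ge> 1"
    and "\<And>v. v \<in> V \<Longrightarrow> N v \<subseteq> V"
    and "\<And>v. v \<in> V \<Longrightarrow> l v < k"
    and "\<And>u v. v \<in> V \<Longrightarrow> u \<in> N v \<Longrightarrow> l u \<noteq> l v"
    and "\<And>v. v \<in> V \<Longrightarrow> card {u \<in> N v. l u < l v} \<le> d"
  shows "\<exists>c. (\<forall>v\<in>V. c v < losing_palette d k) \<and> (\<forall>v\<in>V. s v (restrict c (N v)) \<noteq> c v)"
  using assms
proof (induction k arbitrary: V N s)
  case 0
  then show ?case by auto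
next
  case (Suc k)
  define A where "A = {v \<in> V. l v = k}"
  define B where "B = {v \<in> V. l v < k}"
  define h where "h = losing_palette d k"
  have V: "v \<in> A \<or> v \<in> B" if "v \<in> V" for v
    using Suc.prems(4)[OF that] that by (auto simp: A_def B_def)
  have AB: "v \<notin> B" if "v \<in> A" for v
    using that by (auto simp: A_def B_def)
  \<comment> \<open>No neighbor shares the top level, so the bound on lower neighbors covers the
    whole neighborhood.\<close>
  have NA: "N v \<subseteq> B" "card (N v) \<le> d" "finite (N v)" if "v \<in> A" for v
  proof -
    have v: "v \<in> V" "l v = k" using that by (auto simp: A_def)
    have low: "l u < l v" "u \<in> V" if "u \<in> N v" for u
      using Suc.prems(3-5) v that by (metis less_SucE subsetD)+
    show "N v \<subseteq> B" using low v by (auto simp: B_def)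
    have "{u \<in> N v. l u < l v} = N v" using low by auto
    then show "card (N v) \<le> d" using Suc.prems(6)[OF v(1)] by simp
    show "finite (N v)" using Suc.prems(1) Suc.prems(3)[OF v(1)] by (rule rev_finite_subset)
  qed
  \<comment> \<open>Pigeonhole: at most \<open>h ^ d\<close> views produce at most
    \<open>h ^ d\<close> guesses, so one of \<open>h ^ d + 1\<close> colors is never
    guessed.\<close>
  have "\<exists>a < h ^ d + 1. \<forall>c \<in> N v \<rightarrow>\<^sub>E {..<h}. s v c \<noteq> a" if "v \<in> A" for v
  proof -
    have fin: "finite (N v \<rightarrow>\<^sub>E {..<h})" using NA(3)[OF that] by (simp add: finite_PiE)
    have "card (s v ` (N v \<rightarrow>\<^sub>E {..<h})) \<le> card (N v \<rightarrow>\<^sub>E {..<h})"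
      using fin by (rule card_image_le)
    also have "\<dots> = h ^ card (N v)" using NA(3)[OF that] by (simp add: card_PiE)
    also have "\<dots> \<le> h ^ d"
      using NA(2)[OF that] losing_palette_pos[of d k] by (auto simp: h_def intro: power_increasing)
    also have "\<dots> < card {..<h ^ d + 1}" by simp
    finally have "\<not> {..<h ^ d + 1} \<subseteq> s v ` (N v \<rightarrow>\<^sub>E {..<h})"
      using card_mono[OF finite_imageI[OF fin]] by (metis not_le)
    then show ?thesis by (auto simp: subset_iff image_iff)
  qed
  then obtain a where a: "\<And>v. v \<in> A \<Longrightarrow> a v < h ^ d + 1"
    "\<And>v c. v \<in> A \<Longrightarrow> c \<in> N v \<rightarrow>\<^sub>E {..<h} \<Longrightarrow> s v c \<noteq> a v" by metis
  define extend where "extend c = (\<lambda>v. if v \<in> A then a v else c v)" for c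
  \<comment> \<open>The induction hypothesis is used with neighborhoods
    \<open>N v \<inter> B\<close> and the strategy sending \<open>c\<close> to
    \<open>s v (restrict (extend c) (N v))\<close>: the players in \<open>B\<close> see the top
    level frozen at \<open>a\<close>.\<close>
  have "\<exists>c. (\<forall>v\<in>B. c v < losing_palette d k) \<and>
      (\<forall>v\<in>B. s v (restrict (extend (restrict c (N v \<inter> B))) (N v)) \<noteq> c v)"
  proof (rule Suc.IH)
    show "card {u \<in> N v \<inter> B. l u < l v} \<le> d" if "v \<in> B" for v
    proof -
      have v: "v \<in> V" using that by (simp add: B_def)
      have "finite (N v)" using Suc.prems(1) Suc.prems(3)[OF v] by (rule rev_finite_subset)
      then have "card {u \<in> N v \<inter> B. l u < l v} \<le> card {u \<in> N v. l u < l v}"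
        by (intro card_mono) auto
      then show ?thesis using Suc.prems(6)[OF v] by simp
    qed
  qed (use Suc.prems in \<open>auto simp: B_def\<close>)
  then obtain c where c: "\<And>v. v \<in> B \<Longrightarrow> c v < h"
    "\<And>v. v \<in> B \<Longrightarrow> s v (restrict (extend (restrict c (N v \<inter> B))) (N v)) \<noteq> c v"
    unfolding h_def by blast
  have "extend c v < losing_palette d (Suc k)" if "v \<in> V" for v
    using V[OF that] a(1) c(1) losing_palette_Suc_ge[OF Suc.prems(2), of k]
    by (fastforce simp: extend_def h_def)
  moreover have "s v (restrict (extend c) (N v)) \<noteq> extend c v" if "v \<in> V" for v
  proof (cases "v \<in> A")
    case True
    \<comment> \<open>The lower levels use only \<open>h\<close> colors, so the view of a top vertex
      is among those against which \<open>a\<close> was chosen.\<close>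
    have "restrict (extend c) (N v) \<in> N v \<rightarrow>\<^sub>E {..<h}"
    proof (rule restrict_PiE_iff[THEN iffD2], rule ballI)
      fix x assume "x \<in> N v"
      then have "x \<in> B" by (rule subsetD[OF NA(1)[OF True]])
      moreover from this have "x \<notin> A" using AB by metis
      ultimately show "extend c x \<in> {..<h}" using c(1) by (simp add: extend_def)
    qed
    then show ?thesis using a(2)[OF True] True by (simp add: extend_def)
  next
    case False
    \<comment> \<open>A neighbor lies either in \<open>A\<close>, where \<open>extend\<close>
      ignores its argument, or in \<open>N v \<inter> B\<close>, where the inner restriction changes
      nothing.\<close>
    have "restrict (extend (restrict c (N v \<inter> B))) (N v) = restrict (extend c) (N v)"
      using V subsetD[OF Suc.prems(3)[OF that]] by (intro restrict_ext) (auto simp: extend_def)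
    then show ?thesis using c(2)[of v] V[OF that] False by (simp add: extend_def)
  qed
  ultimately show ?case by blast
qed

lemma left_to_right_path_singleton:
  assumes "v \<in> pverts G" "vertex_ordering G vs"
  shows "left_to_right_path G vs [v]"
proof -
  obtain j where "j < length vs" "vs ! j = v"
    using assms by (metis vertex_ordering_def in_set_conv_nth)
  moreover have "vpath [v] (with_proj G)" using assms(1) by (simp add: vpath_def vwalk_def)
  ultimately show ?thesis
    unfolding left_to_right_path_def by (intro conjI exI[of _ "[j]"]) simp_all
qed

text \<open>The indices of \<open>p\<close> increase and end at \<open>i\<close>, so appending
  \<open>j\<close> keeps them increasing; the new vertex is therefore also distinct from the old
  ones.\<close>

lemma left_to_right_path_append:
  assumes "vertex_ordering G vs" "left_to_right_path G vs p" "last p = vs ! i"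
    and "i < j" "j < length vs" "(vs ! i, vs ! j) \<in> parcs G"
  shows "left_to_right_path G vs (p @ [vs ! j])"
proof -
  obtain js where js: "sorted_wrt (<) js" "set js \<subseteq> {..<length vs}" "p = map ((!) vs) js"
    and p: "vpath p (with_proj G)"
    using assms(2) by (auto simp: left_to_right_path_def)
  have dist: "distinct vs" and vs: "set vs = pverts G"
    using assms(1) by (auto simp: vertex_ordering_def)
  have ne: "js \<noteq> []" using p js(3) by (auto simp: vpath_def vwalk_def)
  then have "last js < length vs" "vs ! last js = vs ! i"
    using js assms(3) last_in_set by (auto simp: last_map)
  \<comment> \<open>Distinctness of \<open>vs\<close> turns equality of vertices into equality of
    positions.\<close>
  then have "last js = i" using dist assms(4,5) by (simp add: nth_eq_iff_index_eq)
  then have lt: "x < j" if "x \<in> set js" for x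
    using js(1) ne that assms(4)
    by (cases js rule: rev_cases) (auto simp: sorted_wrt_append)
  have sorted: "sorted_wrt (<) (js @ [j])" "set (js @ [j]) \<subseteq> {..<length vs}"
    using js lt assms(5) by (auto simp: sorted_wrt_append)
  have eq: "p @ [vs ! j] = map ((!) vs) (js @ [j])" using js by simp
  have "distinct (js @ [j])" using sorted(1) by (simp add: strict_sorted_iff)
  then have "distinct (p @ [vs ! j])"
    unfolding eq using sorted(2) inj_on_nth[OF dist, of "set (js @ [j])"]
    by (auto simp only: distinct_map)
  moreover have "vwalk (p @ [vs ! j]) (with_proj G)"
  proof (rule vwalkI)
    show "set (p @ [vs ! j]) \<subseteq> verts (with_proj G)"
      using p assms(5) vs by (auto simp: vpath_def vwalk_def)
    show "set (vwalk_arcs (p @ [vs ! j])) \<subseteq> arcs_ends (with_proj G)"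
      using p assms(3,6) ne js(3) by (auto simp: vpath_def vwalk_def vwalk_arcs_append)
  qed simp
  ultimately have "vpath (p @ [vs ! j]) (with_proj G)" by (simp add: vpath_def)
  with sorted eq show ?thesis unfolding left_to_right_path_def by blast
qed

text \<open>The level of a vertex is the maximal length of a left-to-right path ending there: the
  depth bounds it, and an edge to the right prolongs such a path.\<close>

lemma exists_level_function:
  assumes "vertex_ordering G vs" "has_depth G vs D"
  obtains l :: "'a \<Rightarrow> nat" where "\<And>v. v \<in> pverts G \<Longrightarrow> l v \<le> D"
    and "\<And>i j. i < j \<Longrightarrow> j < length vs \<Longrightarrow> (vs ! i, vs ! j) \<in> parcs G \<Longrightarrow> l (vs ! i) < l (vs ! j)"
proof -
  define P where "P v = {vwalk_length p | p. left_to_right_path G vs p \<and> last p = v}" for v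
  have bound: "n \<le> D" if "n \<in> P v" for n v
    using that assms(2) by (auto simp: P_def has_depth_def)
  have fin: "finite (P v)" for v
    using bound by (meson finite_atMost finite_subset atMost_iff subsetI)
  have ne: "P v \<noteq> {}" if "v \<in> pverts G" for v
    using left_to_right_path_singleton[OF that assms(1)] by (force simp: P_def)
  show thesis
  proof (rule that[of "\<lambda>v. Max (P v)"])
    show "Max (P v) \<le> D" if "v \<in> pverts G" for v
      using bound[OF Max_in[OF fin ne[OF that]]] .
  next
    fix i j assume ij: "i < j" "j < length vs" "(vs ! i, vs ! j) \<in> parcs G"
    have "i < length vs" using ij by simp
    then have "vs ! i \<in> pverts G" using assms(1) nth_mem by (auto simp: vertex_ordering_def)
    then have "Max (P (vs ! i)) \<in> P (vs ! i)" using fin ne by (intro Max_in)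
    then obtain p where p: "left_to_right_path G vs p" "last p = vs ! i"
      "Max (P (vs ! i)) = vwalk_length p" by (auto simp: P_def)
    \<comment> \<open>Nonemptiness matters for the length: \<open>[]\<close> and a single vertex
      both have length 0.\<close>
    have "p \<noteq> []" using p(1) by (auto simp: left_to_right_path_def vpath_def vwalk_def)
    then have "vwalk_length p < vwalk_length (p @ [vs ! j])" by (simp add: vwalk_length_simp)
    also have "vwalk_length (p @ [vs ! j]) \<in> P (vs ! j)"
      using left_to_right_path_append[OF assms(1) p(1,2) ij] by (force simp: P_def)
    then have "vwalk_length (p @ [vs ! j]) \<le> Max (P (vs ! j))" using fin by simp
    finally show "Max (P (vs ! i)) < Max (P (vs ! j))" using p(3) by simp
  qed
qed

text \<open>Levels run from 0 to \<open>D\<close>, hence \<open>Suc D\<close> of them. The losing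
  coloring stays within the palette, so it remains available for every larger
  \<open>q\<close>.\<close>

lemma not_hat_winning:
  assumes "pair_graph G" "d \<ge> 1" "degenerate_ordering G d vs" "has_depth G vs D"
    and "losing_palette d (Suc D) \<le> q"
  shows "\<not> hat_winning G q s"
proof -
  interpret pair_graph G by fact
  have ord: "vertex_ordering G vs" and dist: "distinct vs" and vs: "set vs = pverts G"
    using assms(3) by (auto simp: degenerate_ordering_def vertex_ordering_def)
  obtain l :: "'a \<Rightarrow> nat" where l: "\<And>v. v \<in> pverts G \<Longrightarrow> l v \<le> D"
    "\<And>i j. i < j \<Longrightarrow> j < length vs \<Longrightarrow> (vs ! i, vs ! j) \<in> parcs G \<Longrightarrow> l (vs ! i) < l (vs ! j)"
    using exists_level_function[OF ord assms(4)] by blast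
  have sym: "(v, u) \<in> parcs G" if "(u, v) \<in> parcs G" for u v
    using that pair_sym_arcs by (simp add: symmetric_def sym_def)
  have order: "\<exists>i j. u = vs ! i \<and> v = vs ! j \<and> j < length vs \<and> i < length vs \<and> i \<noteq> j"
    if "(u, v) \<in> parcs G" for u v
  proof -
    have "u \<in> set vs" "v \<in> set vs" "u \<noteq> v"
      using that vs wellformed' pair_no_loops by fastforce+
    then show ?thesis by (metis in_set_conv_nth)
  qed
  have "\<exists>c. (\<forall>v\<in>pverts G. c v < losing_palette d (Suc D)) \<and>
      (\<forall>v\<in>pverts G. s v (restrict c (neighbors G v)) \<noteq> c v)"
  proof (rule exists_losing_coloring[where l = l])
    show "neighbors G v \<subseteq> pverts G" for v
      using wellformed' by (auto simp: neighbors_def)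
    show "l u \<noteq> l v" if "u \<in> neighbors G v" for u v
    proof -
      have "(u, v) \<in> parcs G" using that by (simp add: neighbors_def)
      moreover obtain i j where "u = vs ! i" "v = vs ! j" "j < length vs" "i < length vs" "i \<noteq> j"
        using order calculation by blast
      \<comment> \<open>One of the two orientations of the edge runs from left to right and strictly
        raises the level.\<close>
      ultimately show ?thesis using l(2) sym by (metis less_irrefl linorder_neqE_nat)
    qed
    show "card {u \<in> neighbors G v. l u < l v} \<le> d" if "v \<in> pverts G" for v
    proof -
      obtain j where j: "j < length vs" "v = vs ! j"
        using \<open>v \<in> pverts G\<close> vs by (metis in_set_conv_nth)
      let ?I = "{i. i < j \<and> vs ! i \<in> neighbors G (vs ! j)}"
      have "{u \<in> neighbors G v. l u < l v} \<subseteq> (!) vs ` ?I"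
      proof
        fix u assume u: "u \<in> {u \<in> neighbors G v. l u < l v}"
        then have uv: "(u, v) \<in> parcs G" by (simp add: neighbors_def)
        then obtain i where i: "u = vs ! i" "i < length vs" "i \<noteq> j"
          using order[OF uv] j by metis
        \<comment> \<open>A neighbor to the right would have a higher level, so the lower neighbors
          lie to the left and degeneracy bounds them.\<close>
        have "\<not> j < i" using l(2)[of j i] sym[OF uv] i j u by auto
        then show "u \<in> (!) vs ` ?I" using i j u by auto
      qed
      then have "card {u \<in> neighbors G v. l u < l v} \<le> card ?I"
        by (intro surj_card_le) simp_all
      also have "\<dots> \<le> d" using assms(3) j(1) by (simp add: degenerate_ordering_def)
      finally show ?thesis .
    qed
  qed (use assms(2) l(1) pair_finite_verts in \<open>auto simp: less_Suc_eq_le\<close>)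
  then obtain c where c: "\<And>v. v \<in> pverts G \<Longrightarrow> c v < losing_palette d (Suc D)"
    "\<And>v. v \<in> pverts G \<Longrightarrow> s v (restrict c (neighbors G v)) \<noteq> c v" by blast
  \<comment> \<open>Members of \<open>colorings\<close> are extensional, so \<open>c\<close> is cut
    down to the vertex set; neighborhoods lie inside it, so no view changes.\<close>
  let ?c = "restrict c (pverts G)"
  have "?c \<in> colorings q (pverts G)" using c(1) assms(5) by (fastforce simp: colorings_def)
  moreover have "restrict ?c (neighbors G v) = restrict c (neighbors G v)" for v
    using wellformed' by (auto simp: neighbors_def fun_eq_iff)
  moreover have "s v (restrict ?c (neighbors G v)) \<noteq> ?c v" if "v \<in> pverts G" for v
    using c(2)[OF that] that calculation(2) by simp
  ultimately show ?thesis unfolding hat_winning_def by blast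
qed

theorem theorem2:
  fixes G :: "'a pair_pre_digraph" and d D :: nat
  assumes "pair_graph G"
    and "d \<ge> 2" and "D \<ge> 1"
    and "\<exists>vs. degenerate_ordering G d vs \<and> has_depth G vs D"
  shows "hat_guessing_number G < enat (2 ^ (d ^ (D + 1)))"
proof -
  obtain vs where vs: "degenerate_ordering G d vs" "has_depth G vs D" using assms(4) by blast
  \<comment> \<open>A uniform non-strict bound passes to the supremum;
    \<open>losing_palette_less\<close> then supplies the strictness.\<close>
  have "q \<le> losing_palette d (Suc D)" if "hat_winning G q s" for q s
    using not_hat_winning[OF assms(1) _ vs, of q s] assms(2) that by linarith
  then have "hat_guessing_number G \<le> enat (losing_palette d (Suc D))"
    unfolding hat_guessing_number_def by (intro Sup_least) auto
  also have "\<dots> < enat (2 ^ (d ^ (D + 1)))"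
    using losing_palette_less[OF assms(2), of "Suc D"] by simp
  finally show ?thesis .
qed

end
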